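(* Let $N\in\mathbb{N}$. Given $F\in L^2(\Omega,\mathcal{F}_N)$, let $$\eta_n=\frac{1}{S_{n-1}\sqrt{p_nq_n}\,(b_n-a_n)}\,E^*[D_nF\mid\mathcal{F}_{n-1}]\prod_{k=n+1}^N(1+r_k)^{-1},\qquad0\le n\le N,$$ and $$\zeta_n=A_n^{-1}\left(\prod_{k=n+1}^N(1+r_k)^{-1}E^*[F\mid\mathcal{F}_n]-\eta_nS_n\right),\qquad0\le n\le N.$$ Then the portfolio $(\eta_k,\zeta_k)_{0\le k\le N}$ (a pair of predictable processes) is self-financing, i.e. $$A_n(\zeta_{n+1}-\zeta_n)+S_n(\eta_{n+1}-\eta_n)=0,\qquad0\le n\le N-1,$$ and satisfies $$\zeta_nA_n+\eta_nS_n=\prod_{k=n+1}^N(1+r_k)^{-1}E^*[F\mid\mathcal{F}_n],\qquad0\le n\le N;$$ in particular its value at time $N$ is $V_N=\zeta_NA_N+\eta_NS_N=F$, hence $(\eta_k,\zeta_k)_{0\le k\le N}$ is a hedging strategy leading to $F$.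
   Context: $\mathbb{N}=\{0,1,2,\ldots\}$. Let $\Omega=\{-1,1\}^{\mathbb{N}}$ with canonical projections $X_k:\Omega\to\{-1,1\}$, $\mathcal{F}_n=\sigma(X_0,\ldots,X_n)$ for $n\ge0$, $\mathcal{F}_{-1}=\{\emptyset,\Omega\}$. Let $(a_k),(b_k),(r_k)$, $k\in\mathbb{N}$, be deterministic real sequences with $-1<a_k<r_k<b_k$. The riskless asset is $A_n=A_{-1}\prod_{k=0}^n(1+r_k)$, and the stock price is given by $S_n=(1+b_n)S_{n-1}$ if $X_n=1$ and $S_n=(1+a_n)S_{n-1}$ if $X_n=-1$, $n\in\mathbb{N}$, with deterministic initial values $A_{-1}>0$, $S_{-1}>0$. Let $p_k=(r_k-a_k)/(b_k-a_k)$, $q_k=(b_k-r_k)/(b_k-a_k)$, and let $\mathbb{P}^*$ be the product probability measure on $\Omega$ under which the $X_k$ are independent with $\mathbb{P}^*(X_k=1)=p_k$, $\mathbb{P}^*(X_k=-1)=q_k$; $E^*$ is expectation under $\mathbb{P}^*$. For $F:\Omega\to\mathbb{R}$, $D_kF(\omega)=\sqrt{p_kq_k}\,(F(\omega_+^k)-F(\omega_-^k))$, where $\omega_\pm^k$ is $\omega$ with its $k$-th coordinate replaced by $\pm1$. A process $(u_k)$ is predictable if $u_k$ is $\mathcal{F}_{k-1}$-measurable for all $k$. Empty products equal $1$. *)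

theory Defs
  imports "HOL-Probability.Probability"
begin

definition Omega :: "(nat \<Rightarrow> int) set" where
  "Omega = (UNIV \<rightarrow>\<^sub>E {-1, 1})"

definition X :: "nat \<Rightarrow> (nat \<Rightarrow> int) \<Rightarrow> int" where
  "X k \<omega> = \<omega> k"

(* Time is an integer j \<ge> -1, so that filt (-1) is the trivial sigma-algebra
   and stock (-1) the initial price; for n :: nat, the objects with index n - 1
   are written with "int n - 1". *)

definition filt :: "int \<Rightarrow> (nat \<Rightarrow> int) measure" where
  "filt j = sigma Omega {X k -` B \<inter> Omega | k B. int k \<le> j}"

definition up_prob :: "(nat \<Rightarrow> real) \<Rightarrow> (nat \<Rightarrow> real) \<Rightarrow> (nat \<Rightarrow> real) \<Rightarrow> nat \<Rightarrow> real" where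
  "up_prob a b r k = (r k - a k) / (b k - a k)"

definition down_prob :: "(nat \<Rightarrow> real) \<Rightarrow> (nat \<Rightarrow> real) \<Rightarrow> (nat \<Rightarrow> real) \<Rightarrow> nat \<Rightarrow> real" where
  "down_prob a b r k = (b k - r k) / (b k - a k)"

definition Pstar ::
  "(nat \<Rightarrow> real) \<Rightarrow> (nat \<Rightarrow> real) \<Rightarrow> (nat \<Rightarrow> real) \<Rightarrow> (nat \<Rightarrow> int) measure" where
  "Pstar a b r = PiM UNIV (\<lambda>k. point_measure {-1, 1}
     (\<lambda>x. ennreal (if x = 1 then up_prob a b r k else down_prob a b r k)))"

definition bond :: "real \<Rightarrow> (nat \<Rightarrow> real) \<Rightarrow> nat \<Rightarrow> real" where
  "bond A0 r n = A0 * (\<Prod>k=0..n. 1 + r k)"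

(* stock_before n is the price at time n - 1. *)
primrec stock_before ::
  "real \<Rightarrow> (nat \<Rightarrow> real) \<Rightarrow> (nat \<Rightarrow> real) \<Rightarrow> nat \<Rightarrow> (nat \<Rightarrow> int) \<Rightarrow> real" where
  "stock_before S0 a b 0 \<omega> = S0"
| "stock_before S0 a b (Suc n) \<omega> =
     (if X n \<omega> = 1 then 1 + b n else 1 + a n) * stock_before S0 a b n \<omega>"

definition stock ::
  "real \<Rightarrow> (nat \<Rightarrow> real) \<Rightarrow> (nat \<Rightarrow> real) \<Rightarrow> int \<Rightarrow> (nat \<Rightarrow> int) \<Rightarrow> real" where
  "stock S0 a b j = stock_before S0 a b (nat (j + 1))"

lemma stock_initial: "stock S0 a b (-1) \<omega> = S0"
  by (simp add: stock_def)

lemma stock_step: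
  "stock S0 a b (int n) \<omega> =
     (if X n \<omega> = 1 then 1 + b n else 1 + a n) * stock S0 a b (int n - 1) \<omega>"
  by (simp add: stock_def nat_add_distrib)

definition gradient ::
  "(nat \<Rightarrow> real) \<Rightarrow> (nat \<Rightarrow> real) \<Rightarrow> (nat \<Rightarrow> real) \<Rightarrow> nat \<Rightarrow>
   ((nat \<Rightarrow> int) \<Rightarrow> real) \<Rightarrow> (nat \<Rightarrow> int) \<Rightarrow> real" where
  "gradient a b r k F \<omega> =
     sqrt (up_prob a b r k * down_prob a b r k) * (F (fun_upd \<omega> k 1) - F (fun_upd \<omega> k (-1)))"

definition predictable :: "nat \<Rightarrow> (nat \<Rightarrow> (nat \<Rightarrow> int) \<Rightarrow> real) \<Rightarrow> bool" where
  "predictable N u \<longleftrightarrow> (\<forall>k\<le>N. u k \<in> borel_measurable (filt (int k - 1)))"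

(* In the following, A n is the bond price and S n the stock price at time n,
   \<zeta> is the number of bonds and \<eta> the number of stocks held. *)

definition self_financing ::
  "nat \<Rightarrow> (nat \<Rightarrow> real) \<Rightarrow> (nat \<Rightarrow> (nat \<Rightarrow> int) \<Rightarrow> real) \<Rightarrow>
   (nat \<Rightarrow> (nat \<Rightarrow> int) \<Rightarrow> real) \<Rightarrow> (nat \<Rightarrow> (nat \<Rightarrow> int) \<Rightarrow> real) \<Rightarrow> bool" where
  "self_financing N A S \<eta> \<zeta> \<longleftrightarrow>
     (\<forall>n<N. \<forall>\<omega>\<in>Omega.
        A n * (\<zeta> (n + 1) \<omega> - \<zeta> n \<omega>) + S n \<omega> * (\<eta> (n + 1) \<omega> - \<eta> n \<omega>) = 0)"

definition portfolio_value ::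
  "(nat \<Rightarrow> real) \<Rightarrow> (nat \<Rightarrow> (nat \<Rightarrow> int) \<Rightarrow> real) \<Rightarrow>
   (nat \<Rightarrow> (nat \<Rightarrow> int) \<Rightarrow> real) \<Rightarrow> (nat \<Rightarrow> (nat \<Rightarrow> int) \<Rightarrow> real) \<Rightarrow>
   nat \<Rightarrow> (nat \<Rightarrow> int) \<Rightarrow> real" where
  "portfolio_value A S \<eta> \<zeta> n \<omega> = \<zeta> n \<omega> * A n + \<eta> n \<omega> * S n \<omega>"

definition hedging_strategy ::
  "nat \<Rightarrow> (nat \<Rightarrow> real) \<Rightarrow> (nat \<Rightarrow> (nat \<Rightarrow> int) \<Rightarrow> real) \<Rightarrow>
   (nat \<Rightarrow> (nat \<Rightarrow> int) \<Rightarrow> real) \<Rightarrow> (nat \<Rightarrow> (nat \<Rightarrow> int) \<Rightarrow> real) \<Rightarrow>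
   ((nat \<Rightarrow> int) \<Rightarrow> real) \<Rightarrow> bool" where
  "hedging_strategy N A S \<eta> \<zeta> F \<longleftrightarrow>
     predictable N \<eta> \<and> predictable N \<zeta> \<and> self_financing N A S \<eta> \<zeta> \<and>
     (\<forall>\<omega>\<in>Omega. portfolio_value A S \<eta> \<zeta> N \<omega> = F \<omega>)"

end

theory Submission
  imports Defs
begin

text \<open>
  The conditional expectations \<open>M\<^sub>n = E\<^sup>*[F | \<F>\<^sub>n]\<close> satisfy the backward recursion
  \<open>M\<^sub>n\<^sub>-\<^sub>1 = p\<^sub>n M\<^sub>n(\<omega>\<^sub>+\<^sup>n) + q\<^sub>n M\<^sub>n(\<omega>\<^sub>-\<^sup>n)\<close>, and by independence \<open>E\<^sup>*[D\<^sub>nF | \<F>\<^sub>n\<^sub>-\<^sub>1]\<close> is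
  \<open>sqrt (p\<^sub>n q\<^sub>n)\<close> times the jump \<open>M\<^sub>n(\<omega>\<^sub>+\<^sup>n) - M\<^sub>n(\<omega>\<^sub>-\<^sup>n)\<close>. So \<open>\<eta>\<^sub>n\<close> is the jump of the discounted
  claim divided by the jump \<open>(b\<^sub>n - a\<^sub>n) S\<^sub>n\<^sub>-\<^sub>1\<close> of the stock, and checking \<open>X\<^sub>n = 1\<close> and \<open>X\<^sub>n = -1\<close>
  separately shows that the portfolio \<open>(\<eta>\<^sub>n, \<zeta>\<^sub>n)\<close> has, at the prices of time \<open>n - 1\<close>, the value
  of the portfolio held before. This gives self-financing, and predictability of \<open>\<zeta>\<close>. All identities
  hold at every point and not just almost surely, since the atoms of \<open>\<F>\<^sub>n\<close> have positive probability.
\<close>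

section \<open>Measurability with respect to finitely many coordinates\<close>

lemma space_filt: "space (filt j) = Omega"
  unfolding filt_def by (rule space_measure_of) auto

lemma sets_filt:
  "sets (filt j) = sigma_sets Omega {X k -` B \<inter> Omega | k B. int k \<le> j}"
  unfolding filt_def by (rule sets_measure_of) auto

lemma subalgebra_filt: "i \<le> j \<Longrightarrow> subalgebra (filt j) (filt i)"
  unfolding subalgebra_def space_filt sets_filt
  by (auto intro!: sigma_sets_mono' dest: order_trans)

lemma fun_upd_in_Omega: "w \<in> Omega \<Longrightarrow> x \<in> {-1, 1} \<Longrightarrow> w(m := x) \<in> Omega"
  by (auto simp: Omega_def PiE_iff)

lemma Omega_coord: "w \<in> Omega \<Longrightarrow> w k \<in> {-1, 1}"
  by (auto simp: Omega_def PiE_iff)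

text \<open>The preimage of a generator at time \<open>m\<close> is everything or empty, and a
  generator at another time is its own preimage. Hence time \<open>m\<close> is exempt in
  \<open>le\<close>: freezing the last coordinate lowers the measurability index by one.\<close>

lemma fun_upd_measurable:
  assumes x: "x \<in> {-1, 1}" and le: "\<And>k. int k \<le> j \<Longrightarrow> k \<noteq> m \<Longrightarrow> int k \<le> i"
  shows "(\<lambda>w. w(m := x)) \<in> measurable (filt i) (filt j)"
proof -
  have "(\<lambda>w. w(m := x)) -` A \<inter> space (filt i) \<in> sets (filt i)"
    if "A \<in> {X k -` B \<inter> Omega | k B. int k \<le> j}" for A
  proof -
    from that obtain k B where A: "A = X k -` B \<inter> Omega" and k: "int k \<le> j" by auto
    show ?thesis
    proof (cases "k = m")
      case True
      then have "(\<lambda>w. w(m := x)) -` A \<inter> space (filt i) = (if x \<in> B then space (filt i) else {})"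
        using fun_upd_in_Omega[OF _ x] by (auto simp: A X_def space_filt)
      then show ?thesis by simp
    next
      case False
      then have "(\<lambda>w. w(m := x)) -` A \<inter> space (filt i) = X k -` B \<inter> Omega"
        using fun_upd_in_Omega[OF _ x] by (auto simp: A X_def space_filt)
      then show ?thesis using le[OF k False] by (auto simp: sets_filt)
    qed
  qed
  then show ?thesis
    unfolding filt_def[of j]
    by (intro measurable_measure_of) (auto simp: space_filt intro!: fun_upd_in_Omega[OF _ x])
qed

lemma filt_measurable_mono:
  "f \<in> borel_measurable (filt i) \<Longrightarrow> i \<le> j \<Longrightarrow> f \<in> borel_measurable (filt j)"
  using measurable_from_subalg[OF subalgebra_filt] .

text \<open>Each generator looks at a single coordinate up to \<open>j\<close>, and complements and
  countable unions preserve this invariance.\<close>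

lemma filt_set_depends:
  assumes "A \<in> sets (filt j)" "w \<in> Omega" "w' \<in> Omega" "\<And>k. int k \<le> j \<Longrightarrow> w k = w' k"
  shows "w \<in> A \<longleftrightarrow> w' \<in> A"
  using assms(1) unfolding sets_filt
  by (induction rule: sigma_sets.induct) (use assms in \<open>auto simp: X_def\<close>)

lemma filt_fun_depends:
  fixes f :: "_ \<Rightarrow> real"
  assumes "f \<in> borel_measurable (filt j)" "w \<in> Omega" "w' \<in> Omega"
    "\<And>k. int k \<le> j \<Longrightarrow> w k = w' k"
  shows "f w = f w'"
proof -
  have "f -` {f w'} \<inter> space (filt j) \<in> sets (filt j)"
    using assms(1) by (rule measurable_sets) simp
  from filt_set_depends[OF this assms(2-4)] assms(2,3) show ?thesis by (auto simp: space_filt)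
qed

lemma filt_fun_upd:
  fixes f :: "_ \<Rightarrow> real"
  assumes "f \<in> borel_measurable (filt j)" "w \<in> Omega" "x \<in> {-1, 1}" "j < int m"
  shows "f (w(m := x)) = f w"
  using assms by (intro filt_fun_depends[of f j]) (auto intro!: fun_upd_in_Omega[simplified])

text \<open>Only finitely many two-valued coordinates matter. This is what later makes every
  \<open>filt j\<close>-measurable function bounded, hence integrable.\<close>

lemma finite_range_filt:
  fixes f :: "_ \<Rightarrow> real"
  assumes f: "f \<in> borel_measurable (filt j)"
  shows "finite (f ` Omega)"
proof (rule finite_subset)
  let ?J = "{k. int k \<le> j}"
  \<comment> \<open>The default value 1 after time \<open>j\<close> keeps the padded sequence inside
    \<open>Omega\<close>.\<close>
  let ?e = "\<lambda>w k. if int k \<le> j then w k else (1::int)"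
  have "finite ?J"
    by (rule finite_subset[of _ "{..nat j}"]) auto
  then show "finite (f ` ?e ` (PiE ?J (\<lambda>_. {-1, 1})))"
    by (intro finite_imageI finite_PiE) auto
  show "f ` Omega \<subseteq> f ` ?e ` (PiE ?J (\<lambda>_. {-1, 1}))"
  proof
    fix y assume "y \<in> f ` Omega"
    then obtain w where w: "w \<in> Omega" "y = f w" by auto
    have e: "?e (restrict w ?J) = ?e w" by auto
    have "y = f (?e (restrict w ?J))"
      unfolding w(2) e using w(1)
      by (intro filt_fun_depends[OF f]) (auto simp: Omega_def PiE_iff)
    moreover have "restrict w ?J \<in> PiE ?J (\<lambda>_. {-1, 1})"
      using w(1) by (auto simp: Omega_def PiE_iff)
    ultimately show "y \<in> f ` ?e ` (PiE ?J (\<lambda>_. {-1, 1}))" by blast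
  qed
qed

section \<open>The risk-neutral product measure\<close>

locale binomial_market =
  fixes a b r :: "nat \<Rightarrow> real"
  assumes rates: "-1 < a k \<and> a k < r k \<and> r k < b k"
begin

abbreviation "p \<equiv> up_prob a b r"
abbreviation "q \<equiv> down_prob a b r"
abbreviation "P \<equiv> Pstar a b r"
abbreviation "E j \<equiv> real_cond_exp P (filt j)"

abbreviation coin :: "nat \<Rightarrow> int measure" where
  "coin k \<equiv> point_measure {-1, 1} (\<lambda>x. ennreal (if x = 1 then p k else q k))"

lemma weights_pos: "p k > 0" "q k > 0"
  using rates[of k] by (auto simp: up_prob_def down_prob_def)

lemma weights_sum: "p k + q k = 1"
  using rates[of k] by (simp add: up_prob_def down_prob_def divide_simps)

lemma prob_space_coin: "prob_space (coin k)"
  using weights_pos[of k] weights_sum[of k]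
  by (intro prob_spaceI)
     (simp add: space_point_measure emeasure_point_measure_finite add.commute flip: ennreal_plus)

sublocale product_prob_space coin UNIV
  by (rule product_prob_spaceI) (rule prob_space_coin)

lemma Pstar_eq: "P = PiM UNIV coin"
  by (simp add: Pstar_def)

lemma space_Pstar: "space P = Omega"
  by (simp add: Pstar_eq space_PiM Omega_def space_point_measure)

sublocale Pstar: prob_space P
  unfolding Pstar_eq by (rule prob_space_PiM) (rule prob_space_coin)

lemma subalgebra_Pstar: "subalgebra P (filt j)"
proof -
  have "X k -` B \<inter> Omega \<in> sets P" for k B
  proof -
    \<comment> \<open>Intersecting with \<open>{-1, 1}\<close> turns the arbitrary \<open>B\<close>
      into a measurable set of the coin space.\<close>
    have "X k -` B \<inter> Omega = {w \<in> space P. w k \<in> B \<inter> {-1, 1}}"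
      by (auto simp: X_def space_Pstar dest: Omega_coord)
    also have "\<dots> \<in> sets P"
      unfolding Pstar_eq
      by (rule sets_Collect_single) (auto simp: sets_point_measure)
    finally show ?thesis .
  qed
  then show ?thesis
    unfolding subalgebra_def sets_filt space_filt space_Pstar
    by (auto simp flip: space_Pstar intro!: sets.sigma_sets_subset)
qed

sublocale sub: finite_measure_subalgebra P "filt j" for j
  by unfold_locales (rule subalgebra_Pstar)

lemma integrable_filt:
  fixes f :: "_ \<Rightarrow> real"
  assumes f: "f \<in> borel_measurable (filt j)"
  shows "integrable P f"
proof -
  obtain B where "\<forall>y\<in>f ` Omega. norm y \<le> B"
    using finite_imp_bounded[OF finite_range_filt[OF f]] unfolding bounded_iff by blast
  then show ?thesis
    using measurable_from_subalg[OF subalgebra_Pstar f]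
    by (intro Pstar.integrable_const_bound[of _ B]) (auto simp: space_Pstar intro!: AE_I2)
qed

text \<open>A disagreement at \<open>w\<close> would spread to the whole cylinder \<open>?C\<close>
  of sequences agreeing with \<open>w\<close> up to \<open>j\<close>, whose probability is a finite
  product of positive weights. This lemma turns every almost sure identity below into a pointwise
  one.\<close>

lemma AE_eq_imp_eq:
  fixes f g :: "_ \<Rightarrow> real"
  assumes ae: "AE w in P. f w = g w"
    and f: "f \<in> borel_measurable (filt j)" and g: "g \<in> borel_measurable (filt j)"
    and w: "w \<in> Omega"
  shows "f w = g w"
proof (rule ccontr)
  assume neq: "f w \<noteq> g w"
  let ?J = "{k. int k \<le> j}"
  let ?C = "{x \<in> space (PiM UNIV coin). \<forall>k\<in>?J. x k \<in> {w k}}"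
  have fin: "finite ?J"
    by (rule finite_subset[of _ "{..nat j}"]) auto
  have "emeasure P ?C = (\<Prod>k\<in>?J. emeasure (coin k) {w k})"
    unfolding Pstar_eq using Omega_coord[OF w]
    by (intro emeasure_PiM_Collect fin) (auto simp: sets_point_measure)
  also have "\<dots> \<noteq> 0"
  proof -
    have "emeasure (coin k) {w k} \<noteq> 0" for k
      using Omega_coord[OF w, of k] weights_pos[of k]
      by (subst emeasure_point_measure_finite) auto
    then show ?thesis using fin by simp
  qed
  finally have pos: "emeasure P ?C \<noteq> 0" .
  have sub: "?C \<subseteq> {x \<in> space P. \<not> f x = g x}"
  proof
    fix x assume "x \<in> ?C"
    then have x: "x \<in> Omega" "\<And>k. int k \<le> j \<Longrightarrow> x k = w k"
      by (auto simp: space_Pstar simp flip: Pstar_eq)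
    have "f x = f w" "g x = g w"
      using filt_fun_depends[OF f x(1) w x(2)] filt_fun_depends[OF g x(1) w x(2)] by auto
    with neq x(1) show "x \<in> {x \<in> space P. \<not> f x = g x}" by (simp add: space_Pstar)
  qed
  have D: "{x \<in> space P. \<not> f x = g x} \<in> sets P"
    using borel_measurable_neq[OF measurable_from_subalg[OF subalgebra_Pstar f]
        measurable_from_subalg[OF subalgebra_Pstar g]] by simp
  have "emeasure P {x \<in> space P. \<not> f x = g x} = 0"
    using AE_iff_measurable[OF D refl] ae by simp
  with pos emeasure_mono[OF sub D] show False by simp
qed

section \<open>Pointwise conditional expectations\<close>

lemma cond_exp_of_measurable:
  assumes "f \<in> borel_measurable (filt j)" "w \<in> Omega"
  shows "E j f w = f w"
  using sub.real_cond_exp_F_meas[OF integrable_filt[OF assms(1)] assms(1)] assms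
  by (intro AE_eq_imp_eq) auto

lemma cond_exp_tower:
  assumes "f \<in> borel_measurable (filt k)" "i \<le> j" "w \<in> Omega"
  shows "E i (E j f) w = E i f w"
  using sub.real_cond_exp_nested_subalg[OF subalgebra_Pstar subalgebra_filt[OF assms(2)]
      integrable_filt[OF assms(1)]]
  by (rule AE_eq_imp_eq[OF _ borel_measurable_cond_exp borel_measurable_cond_exp assms(3)])

lemma fun_upd_meas:
  fixes H :: "_ \<Rightarrow> real"
  assumes "H \<in> borel_measurable (filt (int m))" "x \<in> {-1, 1}"
  shows "(\<lambda>w. H (w(m := x))) \<in> borel_measurable (filt (int m - 1))"
  by (rule measurable_compose[OF fun_upd_measurable assms(1)]) (use assms in auto)

text \<open>\<open>P\<close> is the law of a sequence glued from an independent coin at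
  \<open>m\<close> and the remaining coordinates; Fubini lets the coin be integrated first.\<close>

lemma integral_coordinate:
  fixes H :: "_ \<Rightarrow> real"
  assumes H: "integrable P H"
  shows "integral\<^sup>L P H =
    (\<integral>w. p m * H (w(m := 1)) + q m * H (w(m := -1)) \<partial>PiM (UNIV - {m}) coin)"
proof -
  let ?Q = "PiM (UNIV - {m}) coin"
  let ?T = "\<lambda>(x, w). w(m := x)"
  interpret Q: prob_space ?Q
    by (rule prob_space_PiM) (rule prob_space_coin)
  interpret C: prob_space "coin m" by (rule prob_space_coin)
  interpret MQ: pair_sigma_finite "coin m" ?Q
    by unfold_locales
  have ins: "insert m (UNIV - {m}) = UNIV" by auto
  have T: "?T \<in> measurable (coin m \<Otimes>\<^sub>M ?Q) (PiM UNIV coin)"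
    unfolding case_prod_beta' by (rule measurable_fun_upd[where J = "UNIV - {m}"]) auto
  have D: "P = distr (coin m \<Otimes>\<^sub>M ?Q) (PiM UNIV coin) ?T"
    using distr_pair_PiM_eq_PiM[of "UNIV - {m}" coin m] prob_space_coin
    by (simp add: ins Pstar_eq)
  have Hm: "H \<in> borel_measurable (PiM UNIV coin)" using H by (auto simp flip: Pstar_eq)
  have int: "integrable (coin m \<Otimes>\<^sub>M ?Q) (\<lambda>(x, w). H (w(m := x)))"
    using H unfolding D integrable_distr_eq[OF T Hm] by (simp add: case_prod_beta')
  have "integral\<^sup>L P H = integral\<^sup>L (coin m \<Otimes>\<^sub>M ?Q) (\<lambda>(x, w). H (w(m := x)))"
    unfolding D integral_distr[OF T Hm] by (simp add: case_prod_beta')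
  also have "\<dots> = (\<integral>w. (\<integral>x. H (w(m := x)) \<partial>coin m) \<partial>?Q)"
    by (rule MQ.integral_snd[symmetric]) (rule int)
  also have "\<dots> = (\<integral>w. p m * H (w(m := 1)) + q m * H (w(m := -1)) \<partial>?Q)"
    using weights_pos[of m]
    by (subst lebesgue_integral_point_measure_finite) (auto simp: add.commute less_imp_le)
  finally show ?thesis .
qed

text \<open>The average over coordinate \<open>m\<close> has the defining property of the
  conditional expectation: it no longer depends on that coordinate, and by
  \<open>integral_coordinate\<close> it has the same integral as \<open>H\<close> over each set of
  \<open>filt (int m - 1)\<close>.\<close>

lemma cond_exp_step:
  fixes H :: "_ \<Rightarrow> real"
  assumes H: "H \<in> borel_measurable (filt (int m))" and w: "w \<in> Omega"
  shows "E (int m - 1) H w = p m * H (w(m := 1)) + q m * H (w(m := -1))"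
proof -
  let ?K = "\<lambda>w. p m * H (w(m := 1)) + q m * H (w(m := -1))"
  have [measurable]: "(\<lambda>w. H (w(m := 1))) \<in> borel_measurable (filt (int m - 1))"
    "(\<lambda>w. H (w(m := -1))) \<in> borel_measurable (filt (int m - 1))"
    using fun_upd_meas[OF H] by auto
  have K: "?K \<in> borel_measurable (filt (int m - 1))" by measurable
  have "AE w in P. E (int m - 1) H w = ?K w"
  proof (rule sub.real_cond_exp_charact)
    fix A assume A: "A \<in> sets (filt (int m - 1))"
    then have A': "A \<in> sets P" using subalgebra_Pstar by (auto simp: subalgebra_def)
    let ?I = "indicator A :: _ \<Rightarrow> real"
    have I: "?I \<in> borel_measurable (filt (int m - 1))" using A by simp
    let ?Q = "PiM (UNIV - {m}) coin"
    have upd: "w(m := x) \<in> Omega" if "w \<in> space ?Q" "x \<in> {-1, 1}" for w x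
      using that by (auto simp: space_PiM space_point_measure Omega_def PiE_iff)
    \<comment> \<open>Membership in \<open>A\<close> is decided before time
      \<open>m\<close>.\<close>
    have *: "?I (w(m := -1)) = ?I (w(m := 1))" if "w \<in> space ?Q" for w
      using filt_fun_upd[OF I upd[OF that, of 1], where x = "-1" and m = m] by simp
    have "(\<integral>x\<in>A. H x \<partial>P) = (\<integral>x. ?I x * H x \<partial>P)"
      by (simp add: set_lebesgue_integral_def)
    also have "\<dots> = (\<integral>w. p m * (?I (w(m := 1)) * H (w(m := 1)))
        + q m * (?I (w(m := -1)) * H (w(m := -1))) \<partial>?Q)"
      using integrable_mult_indicator[OF A' integrable_filt[OF H]]
      by (intro integral_coordinate) simp
    also have "\<dots> = (\<integral>w. p m * (?I (w(m := 1)) * ?K (w(m := 1)))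
        + q m * (?I (w(m := -1)) * ?K (w(m := -1))) \<partial>?Q)"
    proof (rule Bochner_Integration.integral_cong[OF refl])
      fix w assume w: "w \<in> space ?Q"
      \<comment> \<open>Averaging a second time with weights of sum 1 changes nothing.\<close>
      have "p m * (i * h) + q m * (i * h') =
          p m * (i * (p m * h + q m * h')) + q m * (i * (p m * h + q m * h'))" for i h h'
      proof -
        have "p m * (i * (p m * h + q m * h')) + q m * (i * (p m * h + q m * h'))
            = (p m + q m) * (i * (p m * h + q m * h'))" by (simp only: distrib_right)
        also have "\<dots> = p m * (i * h) + q m * (i * h')"
          by (simp only: weights_sum) (simp add: algebra_simps)
        finally show ?thesis by (rule sym)
      qed
      then show "p m * (?I (w(m := 1)) * H (w(m := 1)))
          + q m * (?I (w(m := -1)) * H (w(m := -1))) =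
        p m * (?I (w(m := 1)) * ?K (w(m := 1))) + q m * (?I (w(m := -1)) * ?K (w(m := -1)))"
        unfolding *[OF w] fun_upd_upd .
    qed
    also have "\<dots> = (\<integral>x. ?I x * ?K x \<partial>P)"
      using integrable_mult_indicator[OF A' integrable_filt[OF K]]
      by (intro integral_coordinate[symmetric]) simp
    also have "\<dots> = (\<integral>x\<in>A. ?K x \<partial>P)"
      by (simp add: set_lebesgue_integral_def)
    finally show "(\<integral>x\<in>A. H x \<partial>P) = (\<integral>x\<in>A. ?K x \<partial>P)" .
  qed (fact integrable_filt[OF H] integrable_filt[OF K] K)+
  then show ?thesis
    by (rule AE_eq_imp_eq[OF _ borel_measurable_cond_exp K w])
qed

lemma cond_exp_backward:
  assumes F: "F \<in> borel_measurable (filt k)" and w: "w \<in> Omega"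
  shows "E (int m - 1) F w =
    p m * E (int m) F (w(m := 1)) + q m * E (int m) F (w(m := -1))"
  using cond_exp_step[OF borel_measurable_cond_exp w, of m]
    cond_exp_tower[OF F, of "int m - 1" "int m" w] w by simp

text \<open>Once coordinate \<open>n\<close> is frozen, conditioning on it adds no information. The
  induction runs backward from \<open>N\<close>, where both functions are their own conditional
  expectations, down to \<open>n\<close>; the last step to \<open>n - 1\<close> averages two equal
  values.\<close>

lemma cond_exp_fun_upd:
  assumes F: "F \<in> borel_measurable (filt (int N))" and nN: "n \<le> N"
    and x: "x \<in> {-1, 1}" and w: "w \<in> Omega"
  shows "E (int n - 1) (\<lambda>w. F (w(n := x))) w = E (int n) F (w(n := x))"
proof -
  let ?G = "\<lambda>w. F (w(n := x))"
  have G: "?G \<in> borel_measurable (filt (int N))"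
    by (rule measurable_compose[OF fun_upd_measurable F]) (use x in auto)
  have *: "w \<in> Omega \<Longrightarrow> E (int j) ?G w = E (int j) F (w(n := x))" if "n \<le> j" "j \<le> N" for j w
    using that(2,1)
  proof (induction arbitrary: w rule: inc_induct)
    case base
    then show ?case
      using cond_exp_of_measurable[OF G] cond_exp_of_measurable[OF F] fun_upd_in_Omega[OF _ x]
      by (simp del: fun_upd_apply)
  next
    case (step j)
    \<comment> \<open>Since \<open>n\<close> \<le> \<open>j\<close>, the updates at \<open>n\<close>
      and \<open>Suc j\<close> concern different coordinates and commute.\<close>
    have upd: "y \<in> {-1, 1} \<Longrightarrow> E (int (Suc j)) ?G (w(Suc j := y)) =
        E (int (Suc j)) F (w(n := x, Suc j := y))" for y
      using step.IH[OF fun_upd_in_Omega[OF step.prems(1)], of y "Suc j"] step.prems(2)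
      by (simp add: fun_upd_twist[of n "Suc j"] del: fun_upd_apply)
    show ?case
      using cond_exp_backward[OF G step.prems(1), of "Suc j"]
        cond_exp_backward[OF F fun_upd_in_Omega[OF step.prems(1) x], of "Suc j" n]
        upd[of 1] upd[of "-1"] by (simp del: fun_upd_apply)
  qed
  \<comment> \<open>Both branches of the backward step at \<open>n\<close> are overwritten by
    \<open>x\<close>, so they coincide.\<close>
  have "E (int n - 1) ?G w = (p n + q n) * E (int n) F (w(n := x))"
    using cond_exp_backward[OF G w, of n] *[OF order_refl nN fun_upd_in_Omega[OF w, of _ n]]
    by (simp add: distrib_right)
  then show ?thesis by (simp add: weights_sum)
qed

lemma cond_exp_gradient:
  assumes F: "F \<in> borel_measurable (filt (int N))" and nN: "n \<le> N" and w: "w \<in> Omega"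
  shows "E (int n - 1) (gradient a b r n F) w =
    sqrt (p n * q n) * (E (int n) F (w(n := 1)) - E (int n) F (w(n := -1)))"
proof -
  let ?G = "\<lambda>x w. F (w(n := x))"
  let ?c = "sqrt (p n * q n)"
  have G: "?G x \<in> borel_measurable (filt (int N))" if "x \<in> {-1, 1}" for x
    by (rule measurable_compose[OF fun_upd_measurable F]) (use that in auto)
  have int: "integrable P (?G 1)" "integrable P (?G (-1))"
    using integrable_filt[OF G] by auto
  have "AE w in P. E (int n - 1) (gradient a b r n F) w =
      ?c * (E (int n - 1) (?G 1) w - E (int n - 1) (?G (-1)) w)"
    using sub.real_cond_exp_diff[OF int, of "int n - 1"]
      sub.real_cond_exp_cmult[OF Bochner_Integration.integrable_diff[OF int], of "int n - 1" ?c]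
    by eventually_elim (simp add: gradient_def[abs_def])
  then have "E (int n - 1) (gradient a b r n F) w =
      ?c * (E (int n - 1) (?G 1) w - E (int n - 1) (?G (-1)) w)"
    by (rule AE_eq_imp_eq[OF _ _ _ w, where j = "int n - 1"]) auto
  then show ?thesis
    using cond_exp_fun_upd[OF F nN _ w] by simp
qed

end

section \<open>The stock price and the one-period hedging algebra\<close>

lemma stock_measurable: "stock S0 a b (int n - 1) \<in> borel_measurable (filt (int n - 1))"
proof (induction n)
  case 0
  have "stock S0 a b (int 0 - 1) = (\<lambda>_. S0)" by (auto simp: stock_initial)
  then show ?case by simp
next
  case (Suc n)
  have "X n -` {1} \<inter> Omega \<in> sets (filt (int n))" by (auto simp: sets_filt)
  moreover have "X n -` {1} \<inter> Omega = {w \<in> space (filt (int n)). X n w = 1}"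
    by (auto simp: space_filt)
  ultimately have [measurable]: "Measurable.pred (filt (int n)) (\<lambda>w. X n w = 1)"
    by (simp add: pred_def)
  have [measurable]: "stock S0 a b (int n - 1) \<in> borel_measurable (filt (int n))"
    by (rule filt_measurable_mono[OF Suc]) simp
  have "stock S0 a b (int (Suc n) - 1) =
      (\<lambda>w. (if X n w = 1 then 1 + b n else 1 + a n) * stock S0 a b (int n - 1) w)"
    using stock_step by auto
  then show ?case by simp
qed

lemma stock_pos:
  assumes "\<And>k. -1 < a k" "\<And>k. -1 < b k" "S0 > 0"
  shows "stock S0 a b (int n - 1) w > 0"
proof -
  have "1 + a k > 0" "1 + b k > 0" for k using assms(1,2)[of k] by linarith+
  then have "stock_before S0 a b n w > 0" for n using assms(3) by (induction n) auto
  then show ?thesis by (simp add: stock_def)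
qed

text \<open>One period of the market: \<open>u\<close> and \<open>d\<close> are the conditional
  expectations of the claim after an up and a down move, \<open>e\<close> is the one before the
  move, \<open>c\<close> the discount factor and \<open>h\<close> the money in stock at the old
  price. The factor \<open>b - a\<close> is kept so that both hypotheses can be substituted without
  division.\<close>

lemma
  fixes a b r c e h u d :: real
  assumes e: "e * (b - a) = (r - a) * u + (b - r) * d" and h: "h * (b - a) = c * (u - d)"
  shows hedge_up: "(c * e - (c * u - (1 + b) * h + (1 + r) * h)) * (b - a) = 0"
    and hedge_down: "(c * e - (c * d - (1 + a) * h + (1 + r) * h)) * (b - a) = 0"
proof -
  have "(c * e - (c * u - (1 + b) * h + (1 + r) * h)) * (b - a) =
      c * (e * (b - a)) - c * u * (b - a) + (b - r) * (h * (b - a))"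
    by (simp add: algebra_simps)
  also have "\<dots> = 0" unfolding e h by (simp add: algebra_simps)
  finally show "(c * e - (c * u - (1 + b) * h + (1 + r) * h)) * (b - a) = 0" .
  have "(c * e - (c * d - (1 + a) * h + (1 + r) * h)) * (b - a) =
      c * (e * (b - a)) - c * d * (b - a) - (r - a) * (h * (b - a))"
    by (simp add: algebra_simps)
  also have "\<dots> = 0" unfolding e h by (simp add: algebra_simps)
  finally show "(c * e - (c * d - (1 + a) * h + (1 + r) * h)) * (b - a) = 0" .
qed

theorem proposition15p9:
  fixes a b r :: "nat \<Rightarrow> real" and A0 S0 :: real and N :: nat
    and F :: "(nat \<Rightarrow> int) \<Rightarrow> real"
    and A :: "nat \<Rightarrow> real" and S :: "int \<Rightarrow> (nat \<Rightarrow> int) \<Rightarrow> real"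
    and p q :: "nat \<Rightarrow> real" and P :: "(nat \<Rightarrow> int) measure"
    and \<eta> \<zeta> :: "nat \<Rightarrow> (nat \<Rightarrow> int) \<Rightarrow> real"
  assumes rates: "\<And>k. -1 < a k \<and> a k < r k \<and> r k < b k"
    and initial: "A0 > 0" "S0 > 0"
    and A_eq: "A = bond A0 r"
    and S_eq: "S = stock S0 a b"
    and p_eq: "p = up_prob a b r"
    and q_eq: "q = down_prob a b r"
    and P_eq: "P = Pstar a b r"
    and F_meas: "F \<in> borel_measurable (filt (int N))"
    and F_sq: "integrable P (\<lambda>\<omega>. (F \<omega>)\<^sup>2)"
    and eta: "\<And>n \<omega>. n \<le> N \<Longrightarrow> \<omega> \<in> Omega \<Longrightarrow>
      \<eta> n \<omega> = 1 / (S (int n - 1) \<omega> * sqrt (p n * q n) * (b n - a n))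
        * real_cond_exp P (filt (int n - 1)) (gradient a b r n F) \<omega>
        * (\<Prod>k=n+1..N. inverse (1 + r k))"
    and zeta: "\<And>n \<omega>. n \<le> N \<Longrightarrow> \<omega> \<in> Omega \<Longrightarrow>
      \<zeta> n \<omega> = inverse (A n) *
        ((\<Prod>k=n+1..N. inverse (1 + r k)) * real_cond_exp P (filt (int n)) F \<omega>
          - \<eta> n \<omega> * S (int n) \<omega>)"
  shows "predictable N \<eta> \<and> predictable N \<zeta>
    \<and> self_financing N A (\<lambda>n. S (int n)) \<eta> \<zeta>
    \<and> (\<forall>n\<le>N. \<forall>\<omega>\<in>Omega.
        portfolio_value A (\<lambda>n. S (int n)) \<eta> \<zeta> n \<omega>
          = (\<Prod>k=n+1..N. inverse (1 + r k)) * real_cond_exp P (filt (int n)) F \<omega>)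
    \<and> (\<forall>\<omega>\<in>Omega. portfolio_value A (\<lambda>n. S (int n)) \<eta> \<zeta> N \<omega> = F \<omega>)
    \<and> hedging_strategy N A (\<lambda>n. S (int n)) \<eta> \<zeta> F"
proof -
  interpret binomial_market a b r by unfold_locales (rule rates)
  let ?E = "\<lambda>j. real_cond_exp P (filt j) F"
  define C where "C n = (\<Prod>k=n+1..N. inverse (1 + r k))" for n
  have r_pos: "1 + r k > 0" for k using rates[of k] by linarith
  have S_pos: "S (int n - 1) w > 0" for n w
    unfolding S_eq using rates initial(2) by (intro stock_pos) (meson less_trans)+
  have A_pos: "A n > 0" for n
    unfolding A_eq bond_def using initial(1) r_pos by (simp add: prod_pos)
  have A_Suc: "A (Suc n) = A n * (1 + r (Suc n))" for n
    by (simp add: A_eq bond_def)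
  \<comment> \<open>The product defining \<open>C n\<close> has a first factor, at index
    \<open>Suc n\<close>, only when \<open>n < N\<close>.\<close>
  have C_Suc: "C n * (1 + r (Suc n)) = C (Suc n)" if "n < N" for n
  proof -
    have "C n = inverse (1 + r (Suc n)) * C (Suc n)"
      unfolding C_def using that by (simp add: prod.atLeast_Suc_atMost)
    then show ?thesis using r_pos[of "Suc n"] by simp
  qed
  have S_meas [measurable]: "S (int n - 1) \<in> borel_measurable (filt (int n - 1))" for n
    unfolding S_eq by (rule stock_measurable)
  \<comment> \<open>The square root in the gradient cancels the one in the denominator of
    \<open>\<eta>\<close>, leaving jump of stock position against jump of discounted claim.\<close>
  have eta': "\<eta> n w * S (int n - 1) w * (b n - a n) =
      C n * (?E (int n) (w(n := 1)) - ?E (int n) (w(n := -1)))"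
    if "n \<le> N" "w \<in> Omega" for n w
  proof -
    have "p n \<noteq> 0" "q n \<noteq> 0" using weights_pos[of n] by (auto simp: p_eq q_eq)
    moreover have "b n - a n > 0" using rates[of n] by linarith
    ultimately show ?thesis
      unfolding eta[OF that] C_def[symmetric]
      using S_pos[of n w] cond_exp_gradient[OF F_meas that] by (simp add: P_eq p_eq q_eq)
  qed
  have S_step: "S (int n) w = (if X n w = 1 then 1 + b n else 1 + a n) * S (int n - 1) w" for n w
    unfolding S_eq by (rule stock_step)
  have zeta': "\<zeta> n w * A n + \<eta> n w * S (int n) w = C n * ?E (int n) w"
    if "n \<le> N" "w \<in> Omega" for n w
    unfolding zeta[OF that] C_def[symmetric] using A_pos[of n] by (simp add: field_simps)
  \<comment> \<open>This is the value of the new portfolio at the prices of time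
    \<open>n - 1\<close>, compounded by \<open>1 + r n\<close>. Compounding expresses it through
    \<open>A n\<close>, so that \<open>n = 0\<close> is covered although \<open>bond\<close> has no
    index -1.\<close>
  have value_before: "\<zeta> n w * A n + (1 + r n) * (\<eta> n w * S (int n - 1) w) = C n * ?E (int n - 1) w"
    if n: "n \<le> N" and w: "w \<in> Omega" for n w
  proof -
    have ba: "b n - a n > 0" using rates[of n] by linarith
    let ?u = "?E (int n) (w(n := 1))" and ?d = "?E (int n) (w(n := -1))"
    have E_step: "?E (int n - 1) w * (b n - a n) = (r n - a n) * ?u + (b n - r n) * ?d"
    proof -
      have "?E (int n - 1) w = p n * ?u + q n * ?d"
        using cond_exp_backward[OF F_meas w] by (simp add: P_eq p_eq q_eq)
      moreover have "p n * (b n - a n) = r n - a n" "q n * (b n - a n) = b n - r n"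
        using ba by (simp_all add: p_eq q_eq up_prob_def down_prob_def)
      moreover have "(p n * ?u + q n * ?d) * (b n - a n) =
          (p n * (b n - a n)) * ?u + (q n * (b n - a n)) * ?d"
        by (simp add: algebra_simps)
      ultimately show ?thesis by (simp only:)
    qed
    let ?h = "\<eta> n w * S (int n - 1) w"
    have "(C n * ?E (int n - 1) w - (\<zeta> n w * A n + (1 + r n) * ?h)) * (b n - a n) = 0"
    proof (cases "X n w = 1")
      case True
      then have "w(n := 1) = w" by (auto simp: X_def)
      then have "\<zeta> n w * A n + \<eta> n w * ((1 + b n) * S (int n - 1) w) = C n * ?u"
        using zeta'[OF n w] True unfolding S_step by simp
      then have V: "\<zeta> n w * A n = C n * ?u - (1 + b n) * ?h"
        unfolding mult.left_commute[of "\<eta> n w"] by linarith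
      show ?thesis
        unfolding V using E_step eta'[OF n w] by (rule hedge_up)
    next
      case False
      then have "w n = -1" using Omega_coord[OF w, of n] by (auto simp: X_def)
      then have "w(n := -1) = w" by auto
      then have "\<zeta> n w * A n + \<eta> n w * ((1 + a n) * S (int n - 1) w) = C n * ?d"
        using zeta'[OF n w] False unfolding S_step by simp
      then have V: "\<zeta> n w * A n = C n * ?d - (1 + a n) * ?h"
        unfolding mult.left_commute[of "\<eta> n w"] by linarith
      show ?thesis
        unfolding V using E_step eta'[OF n w] by (rule hedge_down)
    qed
    with ba show ?thesis by simp
  qed
  have pred_eta: "\<eta> n \<in> borel_measurable (filt (int n - 1))" if "n \<le> N" for n
    by (subst measurable_cong[OF eta[OF that]]) (auto simp: space_filt P_eq)
  have pred_zeta: "\<zeta> n \<in> borel_measurable (filt (int n - 1))" if "n \<le> N" for n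
  proof -
    \<comment> \<open>The given formula for \<open>\<zeta>\<close> involves time \<open>n\<close>;
      solving \<open>value_before\<close> for it leaves only quantities known at time
      \<open>n - 1\<close>.\<close>
    have "\<zeta> n w = (C n * ?E (int n - 1) w - (1 + r n) * (\<eta> n w * S (int n - 1) w)) / A n"
      if "w \<in> Omega" for w
      using value_before[OF \<open>n \<le> N\<close> that] A_pos[of n] by (simp add: field_simps)
    moreover have "(\<lambda>w. (C n * ?E (int n - 1) w - (1 + r n) * (\<eta> n w * S (int n - 1) w)) / A n)
        \<in> borel_measurable (filt (int n - 1))"
      using pred_eta[OF \<open>n \<le> N\<close>] by measurable
    ultimately show ?thesis
      by (subst measurable_cong) (auto simp: space_filt)
  qed
  have pred: "predictable N \<eta>" "predictable N \<zeta>"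
    using pred_eta pred_zeta by (auto simp: predictable_def)
  have sf: "self_financing N A (\<lambda>n. S (int n)) \<eta> \<zeta>"
    unfolding self_financing_def
  proof (intro allI impI ballI)
    fix n w assume n: "n < N" and w: "w \<in> Omega"
    \<comment> \<open>\<open>value_before\<close> at \<open>Suc n\<close> prices the next portfolio
      at time \<open>n\<close>. Both sides carry the factor \<open>1 + r (Suc n)\<close>, which is
      then cancelled to compare with \<open>zeta'\<close>.\<close>
    have "(A n * \<zeta> (Suc n) w + S (int n) w * \<eta> (Suc n) w) * (1 + r (Suc n)) =
        C n * (1 + r (Suc n)) * ?E (int n) w"
      unfolding C_Suc[OF n] using value_before[of "Suc n", OF _ w] n
      by (simp add: A_Suc algebra_simps)
    then have "A n * \<zeta> (Suc n) w + S (int n) w * \<eta> (Suc n) w = C n * ?E (int n) w"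
      using r_pos[of "Suc n"] by simp
    then show "A n * (\<zeta> (n + 1) w - \<zeta> n w) + S (int n) w * (\<eta> (n + 1) w - \<eta> n w) = 0"
      using zeta'[of n w] n w by (simp add: algebra_simps)
  qed
  have val: "portfolio_value A (\<lambda>n. S (int n)) \<eta> \<zeta> n w = C n * ?E (int n) w"
    if "n \<le> N" "w \<in> Omega" for n w
    using zeta'[OF that] by (simp add: portfolio_value_def)
  \<comment> \<open>At \<open>N\<close> the discount product is empty, and \<open>F\<close> is its
    own conditional expectation.\<close>
  have valN: "portfolio_value A (\<lambda>n. S (int n)) \<eta> \<zeta> N w = F w" if "w \<in> Omega" for w
    using val[OF order_refl that] cond_exp_of_measurable[OF F_meas that] by (simp add: C_def P_eq)
  show ?thesis
    using pred sf val valN by (simp add: hedging_strategy_def C_def)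
qed

end
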